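(* Let $0<p<q$ and $n=p+q$. Let $\alpha\in\mathbb{R}$, let $V\subset\mathbb{C}^n$ be a maximal isotropic subspace, let $M:(V\oplus sV)^\perp\to V$ be a linear map with $\operatorname{rank}M=1$, and let $N=M-M^*$, with $\operatorname{rank}N=2$. Then the nilpotent loop $$n_{\alpha,1,N}(\lambda)=\mathrm{I}+\frac{1}{\lambda-\alpha}N+\frac12\left(\frac{1}{\lambda-\alpha}\right)^2N^2$$ can be factored as a product of finitely many loops of the form $$g_{\mu,\nu,L,K,W}(\lambda)=\left(\frac{\lambda-\mu}{\lambda-\nu}\right)\pi_L+\left(\frac{\lambda-\bar\nu}{\lambda-\bar\mu}\right)\pi_K+\pi_W,$$ where (possibly different for each factor) $\mu,\nu\in\mathbb{C}$, $L,K\subset\mathbb{C}^n$ are isotropic complex lines with $\langle L,K\rangle\ne0$, and $W=L^\perp\cap K^\perp$.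
   Context: On $\mathbb{C}^n$, $n=p+q$, let $\langle v,w\rangle=-\sum_{i=1}^p\overline{v_i}w_i+\sum_{i=p+1}^{p+q}\overline{v_i}w_i$. The symbol $\perp$ refers to orthogonality with respect to $\langle\cdot,\cdot\rangle$; a subspace is isotropic if $\langle\cdot,\cdot\rangle$ vanishes identically on it, and maximal isotropic if it is maximal among isotropic subspaces. For lines $L,K$, $\langle L,K\rangle\ne0$ means $\langle v,w\rangle\neq0$ for nonzero $v\in L,w\in K$. Put $s=\mathrm{diag}(-\mathrm{I}_p,\mathrm{I}_q)$; $A^*=s\bar A^t s$ is the adjoint with respect to $\langle\cdot,\cdot\rangle$. For isotropic $V$ there is a direct sum decomposition $\mathbb{C}^n=V\oplus(V\oplus sV)^\perp\oplus sV$; a linear map $M:(V\oplus sV)^\perp\to V$ is regarded as an endomorphism of $\mathbb{C}^n$ by extending it by zero on $V\oplus sV$, and $M^*$ is the adjoint of this endomorphism. The projections $\pi_L,\pi_K,\pi_W$ are those of the decomposition $\mathbb{C}^n=L\oplus K\oplus W$, each onto the named summand along the sum of the other two. *)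

theory Defs
  imports "HOL-Analysis.Analysis"
begin

text \<open>
  The space of column vectors of length \<open>p + q\<close> over the complex numbers is rendered as \<open>complex ^ ('p + 'q)\<close>, with \<open>p = CARD('p)\<close> and \<open>q = CARD('q)\<close>;
  the indices \<open>Inl i\<close> are the first \<open>p\<close> coordinates and \<open>Inr j\<close> the last \<open>q\<close>.
  Complex subspaces, dimension and rank are the library notions over the field of scalars
  (\<open>vec.subspace\<close>, \<open>vec.dim\<close>, \<open>rank\<close>), not those over the reals.
\<close>

type_synonym ('p, 'q) cvec = "complex ^ ('p + 'q)"
type_synonym ('p, 'q) cmat = "complex ^ ('p + 'q) ^ ('p + 'q)"

definition herm :: "('p::finite, 'q::finite) cvec \<Rightarrow> ('p, 'q) cvec \<Rightarrow> complex" where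
  "herm v w = - (\<Sum>i\<in>UNIV. cnj (v $ Inl i) * w $ Inl i) + (\<Sum>j\<in>UNIV. cnj (v $ Inr j) * w $ Inr j)"

definition sgn_mat :: "('p::finite, 'q::finite) cmat" where
  "sgn_mat = (\<chi> i j. if i = j then (case i of Inl _ \<Rightarrow> - 1 | Inr _ \<Rightarrow> 1) else 0)"

definition mat_scale :: "complex \<Rightarrow> ('p::finite, 'q::finite) cmat \<Rightarrow> ('p, 'q) cmat" (infixr "*m" 75) where
  "c *m A = map_matrix (\<lambda>x. c * x) A"

definition adj :: "('p::finite, 'q::finite) cmat \<Rightarrow> ('p, 'q) cmat" where
  "adj A = sgn_mat ** transpose (map_matrix cnj A) ** sgn_mat"

definition perp :: "('p::finite, 'q::finite) cvec set \<Rightarrow> ('p, 'q) cvec set" where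
  "perp U = {w. \<forall>v\<in>U. herm v w = 0}"

definition isotropic :: "('p::finite, 'q::finite) cvec set \<Rightarrow> bool" where
  "isotropic U \<longleftrightarrow> vec.subspace U \<and> (\<forall>v\<in>U. \<forall>w\<in>U. herm v w = 0)"

definition maximal_isotropic :: "('p::finite, 'q::finite) cvec set \<Rightarrow> bool" where
  "maximal_isotropic V \<longleftrightarrow> isotropic V \<and> (\<forall>U. isotropic U \<longrightarrow> V \<subseteq> U \<longrightarrow> U = V)"

definition isotropic_line :: "('p::finite, 'q::finite) cvec set \<Rightarrow> bool" where
  "isotropic_line L \<longleftrightarrow> isotropic L \<and> vec.dim L = 1"

definition lines_nonorth :: "('p::finite, 'q::finite) cvec set \<Rightarrow> ('p, 'q) cvec set \<Rightarrow> bool" where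
  "lines_nonorth L K \<longleftrightarrow> (\<forall>v\<in>L. \<forall>w\<in>K. v \<noteq> 0 \<longrightarrow> w \<noteq> 0 \<longrightarrow> herm v w \<noteq> 0)"

definition hyp_sum :: "('p::finite, 'q::finite) cvec set \<Rightarrow> ('p, 'q) cvec set" where
  "hyp_sum V = V + (*v) sgn_mat ` V"

text \<open>
  \<open>M\<close> is the extension by zero on \<open>V \<oplus> sV\<close> of a linear map from the orthogonal
  complement of \<open>V \<oplus> sV\<close> to \<open>V\<close>. Since \<open>V \<oplus> sV\<close> and its complement span the whole space when
  \<open>V\<close> is isotropic, such matrices correspond bijectively to these linear maps, with the same rank.
\<close>

definition ext_by_zero :: "('p::finite, 'q::finite) cvec set \<Rightarrow> ('p, 'q) cmat \<Rightarrow> bool" where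
  "ext_by_zero V M \<longleftrightarrow>
     (\<forall>x\<in>perp (hyp_sum V). M *v x \<in> V) \<and> (\<forall>x\<in>hyp_sum V. M *v x = 0)"

text \<open>
  The projection onto \<open>U\<close> along \<open>U'\<close>; it is meaningful only when the whole space is the
  direct sum of the subspaces \<open>U\<close> and \<open>U'\<close>.
\<close>

definition proj_along :: "('p::finite, 'q::finite) cvec set \<Rightarrow> ('p, 'q) cvec set \<Rightarrow> ('p, 'q) cmat" where
  "proj_along U U' = (THE P. \<forall>u\<in>U. \<forall>u'\<in>U'. P *v (u + u') = u)"

text \<open>
  Loops are given by their values. The formulas below are only meaningful away from the poles:
  \<open>\<alpha>\<close> for the nilpotent loop, and \<open>\<nu>\<close> and \<open>cnj \<mu>\<close> for the simple loop.
\<close>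

definition nil_loop :: "complex \<Rightarrow> ('p::finite, 'q::finite) cmat \<Rightarrow> complex \<Rightarrow> ('p, 'q) cmat" where
  "nil_loop \<alpha> N l = mat 1 + (1 / (l - \<alpha>)) *m N + (1 / 2 * (1 / (l - \<alpha>))\<^sup>2) *m (N ** N)"

definition simple_loop ::
  "complex \<Rightarrow> complex \<Rightarrow> ('p::finite, 'q::finite) cvec set \<Rightarrow> ('p, 'q) cvec set \<Rightarrow> ('p, 'q) cvec set
     \<Rightarrow> complex \<Rightarrow> ('p, 'q) cmat" where
  "simple_loop \<mu> \<nu> L K W l =
     ((l - \<mu>) / (l - \<nu>)) *m proj_along L (K + W)
     + ((l - cnj \<nu>) / (l - cnj \<mu>)) *m proj_along K (L + W)
     + proj_along W (L + K)"

end

theory Submission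
  imports Defs
begin

text \<open>
  The map \<open>M\<close> is \<open>x \<mapsto> \<langle>b, x\<rangle> a\<close> with \<open>a \<in> V\<close> and \<open>b\<close> orthogonal to \<open>V \<oplus> sV\<close>, so that
  \<open>N x = \<langle>b, x\<rangle> a - \<langle>a, x\<rangle> b\<close>. Let \<open>c\<close> be the multiple of \<open>s a\<close> with \<open>\<langle>a, c\<rangle> = 1\<close>, and
  \<open>c' = exp(N) c = c - b - (\<langle>b, b\<rangle> / 2) a\<close>. On the span of \<open>a, b, c\<close> the loop is
  the adjoint representation of the unipotent matrix with upper right entry \<open>-t\<close>, \<open>t = 1 / (\<lambda> - \<alpha>)\<close>,
  and (with \<open>\<alpha> = 0\<close>) the identity of two by two matrices
  \<open>(\<lambda> - A\<^sub>1) diag(\<lambda>, \<lambda> - 1) = \<lambda> (\<lambda> - 1) (1 - t E\<^sub>1\<^sub>2)\<close>, where \<open>A\<^sub>1\<close> has rows \<open>(1, 1)\<close> and \<open>(0, 0)\<close>,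
  exhibits it as a product of two simple loops, both with \<open>L\<close> spanned by \<open>a\<close>.
\<close>

section \<open>The indefinite form and the sign matrix in coordinates\<close>

definition herm_sign :: "'p + 'q \<Rightarrow> complex" where
  "herm_sign k = (case k of Inl _ \<Rightarrow> - 1 | Inr _ \<Rightarrow> 1)"

lemma herm_sign_simps [simp]:
  "herm_sign k * herm_sign k = 1" "herm_sign k * (herm_sign k * z) = z"
  "cnj (herm_sign k) = herm_sign k"
  by (auto simp: herm_sign_def split: sum.splits)

lemma herm_eq_sum: "herm v w = (\<Sum>k\<in>UNIV. herm_sign k * cnj (v $ k) * w $ k)"
proof -
  have "(\<Sum>k\<in>UNIV. herm_sign k * cnj (v $ k) * w $ k)
      = (\<Sum>k\<in>range Inl. herm_sign k * cnj (v $ k) * w $ k)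
        + (\<Sum>k\<in>range Inr. herm_sign k * cnj (v $ k) * w $ k)"
    unfolding UNIV_sum by (rule sum.union_disjoint) auto
  also have "\<dots> = herm v w"
    by (simp add: herm_def sum.reindex herm_sign_def sum_negf)
  finally show ?thesis ..
qed

lemma herm_right [simp]:
  "herm v (x + y) = herm v x + herm v y"
  "herm v (x - y) = herm v x - herm v y"
  "herm v (- x) = - herm v x"
  "herm v (c *s x) = c * herm v x"
  "herm v 0 = 0"
  by (simp_all add: herm_eq_sum sum.distrib sum_subtractf sum_negf sum_distrib_left algebra_simps)

lemma herm_left [simp]:
  "herm (x + y) v = herm x v + herm y v"
  "herm (x - y) v = herm x v - herm y v"
  "herm (- x) v = - herm x v"
  "herm (c *s x) v = cnj c * herm x v"
  "herm 0 v = 0"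
  by (simp_all add: herm_eq_sum sum.distrib sum_subtractf sum_negf sum_distrib_left algebra_simps)

lemma cnj_herm: "cnj (herm v w) = herm w v"
  by (simp add: herm_eq_sum algebra_simps)

lemma sgn_mat_nth: "sgn_mat $ i $ j = (if i = j then herm_sign i else 0)"
  by (simp add: sgn_mat_def herm_sign_def)

lemma sgn_mat_mult_nth: "(sgn_mat *v x) $ k = herm_sign k * x $ k"
  by (simp add: matrix_vector_mult_def sgn_mat_nth if_distrib [of "\<lambda>z. z * _"] cong: if_cong)

text \<open>Twisting by \<open>sgn_mat\<close> cancels the signs, which gives access to Euclidean
  orthogonality.\<close>

lemma Re_herm_sgn_mat: "Re (herm v (sgn_mat *v w)) = inner v w"
  by (simp add: herm_eq_sum sgn_mat_mult_nth inner_vec_def inner_complex_def algebra_simps)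

lemma herm_sgn_mat_self: "herm v (sgn_mat *v v) = of_real (inner v v)"
proof -
  have "herm v (sgn_mat *v v) = (\<Sum>k\<in>UNIV. v $ k * cnj (v $ k))"
    by (simp add: herm_eq_sum sgn_mat_mult_nth algebra_simps)
  also have "\<dots> = of_real (inner v v)"
    by (simp add: inner_vec_def complex_mult_cnj inner_complex_def power2_eq_square)
  finally show ?thesis .
qed

lemma sgn_mat_involution [simp]: "sgn_mat *v (sgn_mat *v x) = x"
  by (simp add: vec_eq_iff sgn_mat_mult_nth)

lemma sgn_mat_isometry [simp]: "herm (sgn_mat *v v) (sgn_mat *v w) = herm v w"
  by (simp add: herm_eq_sum sgn_mat_mult_nth algebra_simps)

section \<open>Rank-one operators\<close>

text \<open>The second factor is the row vector of the functional \<open>herm v\<close>, so that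
  taking adjoints just swaps \<open>u\<close> and \<open>v\<close>.\<close>

definition outer :: "('p::finite, 'q::finite) cvec \<Rightarrow> ('p, 'q) cvec \<Rightarrow> ('p, 'q) cmat" where
  "outer u v = (\<chi> i j. u $ i * (herm_sign j * cnj (v $ j)))"

lemma outer_mult_vec: "outer u v *v x = herm v x *s u"
  by (simp add: vec_eq_iff outer_def matrix_vector_mult_def herm_eq_sum sum_distrib_left
      sum_distrib_right algebra_simps)

lemma adj_nth:
  fixes A :: "('a::finite, 'b::finite) cmat"
  shows "adj A $ i $ j = herm_sign i * cnj (A $ j $ i) * herm_sign j"
proof -
  have left: "(sgn_mat ** B) $ i $ j = herm_sign i * B $ i $ j" for B :: "('a, 'b) cmat" and i j
    by (simp add: matrix_matrix_mult_def sgn_mat_nth if_distrib [of "\<lambda>z. z * _"] cong: if_cong)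
  have right: "(B ** sgn_mat) $ i $ j = B $ i $ j * herm_sign j" for B :: "('a, 'b) cmat" and i j
    by (simp add: matrix_matrix_mult_def sgn_mat_nth if_distrib [of "\<lambda>z. _ * z"] cong: if_cong)
  show ?thesis
    by (simp add: adj_def left right transpose_def map_matrix_def)
qed

lemma adj_outer: "adj (outer u v) = outer v u"
  by (simp add: vec_eq_iff adj_nth outer_def)

lemma mat_scale_mult_vec: "(c *m A) *v x = c *s (A *v x)"
  by (simp add: vec_eq_iff mat_scale_def map_matrix_def matrix_vector_mult_def sum_distrib_left
      algebra_simps)

section \<open>Projections and simple loops for a hyperbolic pair\<close>

lemma proj_along_eqI:
  assumes "\<And>u. u \<in> U \<Longrightarrow> P *v u = u" "\<And>u. u \<in> U' \<Longrightarrow> P *v u = 0"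
    and decomp: "\<And>x. \<exists>u\<in>U. \<exists>u'\<in>U'. x = u + u'"
  shows "proj_along U U' = P"
  unfolding proj_along_def
proof (rule the_equality)
  show P: "\<forall>u\<in>U. \<forall>u'\<in>U'. P *v (u + u') = u"
    using assms by (simp add: matrix_vector_right_distrib)
  fix Q assume "\<forall>u\<in>U. \<forall>u'\<in>U'. Q *v (u + u') = u"
  then have "Q *v x = P *v x" for x
    using decomp[of x] P by auto
  then show "Q = P" by (simp add: matrix_eq)
qed

lemma isotropic_line_span:
  assumes "herm u u = 0" "u \<noteq> 0"
  shows "isotropic_line (vec.span {u})"
  unfolding isotropic_line_def isotropic_def
proof (intro conjI ballI)
  show "vec.dim (vec.span {u}) = 1"
    using assms(2) by (simp only: vec.dim_span vec.dim_singleton if_False)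
  show "herm v w = 0" if "v \<in> vec.span {u}" "w \<in> vec.span {u}" for v w
    using that assms(1) by (auto simp: vec.span_singleton)
qed simp

lemma lines_nonorth_span:
  assumes "herm u v \<noteq> 0"
  shows "lines_nonorth (vec.span {u}) (vec.span {v})"
  using assms by (auto simp: lines_nonorth_def vec.span_singleton)

lemma in_perp_span: "w \<in> perp (vec.span {u}) \<longleftrightarrow> herm u w = 0"
proof
  assume "w \<in> perp (vec.span {u})"
  then show "herm u w = 0"
    unfolding perp_def using vec.span_base[of u "{u}"] by blast
qed (auto simp: perp_def vec.span_singleton)

text \<open>For a hyperbolic pair the projections onto the two lines are \<open>outer u v\<close>
  and \<open>outer v u\<close>, and the rest of the identity projects onto their common
  complement.\<close>

lemma simple_loop_span:
  assumes u: "herm u u = 0" and v: "herm v v = 0" and uv: "herm u v = 1"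
  shows "simple_loop \<mu> \<nu> (vec.span {u}) (vec.span {v}) (perp (vec.span {u}) \<inter> perp (vec.span {v})) l *v x
    = x + (((l - \<mu>) / (l - \<nu>) - 1) * herm v x) *s u
        + (((l - cnj \<nu>) / (l - cnj \<mu>) - 1) * herm u x) *s v"
proof -
  let ?L = "vec.span {u}" and ?K = "vec.span {v}"
  let ?W = "perp ?L \<inter> perp ?K"
  have vu: "herm v u = 1"
    using cnj_herm[of u v] uv by simp
  have L: "k *s u \<in> ?L" and K: "k *s v \<in> ?K" for k
    by (simp_all add: vec.span_base vec.span_scale)
  have W: "x - herm v x *s u - herm u x *s v \<in> ?W" for x
    by (simp add: in_perp_span u v uv vu)
  have dec: "x = herm v x *s u + (herm u x *s v + (x - herm v x *s u - herm u x *s v))"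
    "x = herm u x *s v + (herm v x *s u + (x - herm v x *s u - herm u x *s v))"
    "x = (x - herm v x *s u - herm u x *s v) + (herm v x *s u + herm u x *s v)" for x
    by simp_all
  have pL: "proj_along ?L (?K + ?W) = outer u v"
  proof (rule proj_along_eqI)
    show "\<exists>w\<in>?L. \<exists>w'\<in>?K + ?W. x = w + w'" for x
      using dec(1)[of x] L K W by (meson set_plus_intro)
  qed (auto simp: outer_mult_vec vec.span_singleton vu v set_plus_def in_perp_span[unfolded vec.span_singleton])
  have pK: "proj_along ?K (?L + ?W) = outer v u"
  proof (rule proj_along_eqI)
    show "\<exists>w\<in>?K. \<exists>w'\<in>?L + ?W. x = w + w'" for x
      using dec(2)[of x] L K W by (meson set_plus_intro)
  qed (auto simp: outer_mult_vec vec.span_singleton uv u set_plus_def in_perp_span[unfolded vec.span_singleton])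
  have pW: "proj_along ?W (?L + ?K) = mat 1 - outer u v - outer v u"
  proof (rule proj_along_eqI)
    show "\<exists>w\<in>?W. \<exists>w'\<in>?L + ?K. x = w + w'" for x
      using dec(3)[of x] L K W by (meson set_plus_intro)
  qed (auto simp: outer_mult_vec vec.span_singleton uv vu u v set_plus_def
        matrix_vector_mult_diff_rdistrib in_perp_span[unfolded vec.span_singleton])
  show ?thesis
    unfolding simple_loop_def pL pK pW
    by (simp add: matrix_vector_mult_diff_rdistrib matrix_vector_mult_add_rdistrib
        mat_scale_mult_vec outer_mult_vec vec_eq_iff algebra_simps)
qed

section \<open>The factorization\<close>

text \<open>Since \<open>exp(N)\<close> is an isometry fixing \<open>a\<close> and sending
  \<open>c\<close> to \<open>c'\<close>, \<open>?g1\<close> is the conjugate of the inverse of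
  \<open>?g2\<close> by \<open>exp(N)\<close>. Conjugation by \<open>?g2\<close> rescales
  \<open>N\<close>: \<open>?g2\<inverse> N ?g2 = f N\<close> with \<open>f = 1 - t\<close>. Hence
  the product is \<open>exp(N) exp(- f N) = exp(t N)\<close>, and \<open>N^3 = 0\<close> makes this
  the nilpotent loop. The proof verifies the identity by direct computation.\<close>

lemma nil_loop_factorization:
  fixes \<alpha> :: real and l :: complex and a b c :: "('p::finite, 'q::finite) cvec"
  assumes a: "herm a a = 0" and c: "herm c c = 0" and ac: "herm a c = 1"
    and ab: "herm a b = 0" and cb: "herm c b = 0"
    and l: "l \<noteq> \<alpha>" "l \<noteq> of_real \<alpha> + 1"
  defines "c' \<equiv> c - b - (herm b b / 2) *s a"
  shows "nil_loop \<alpha> (outer a b - outer b a) l =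
      simple_loop (of_real \<alpha> + 1) \<alpha> (vec.span {a}) (vec.span {c'}) (perp (vec.span {a}) \<inter> perp (vec.span {c'})) l
      ** simple_loop \<alpha> (of_real \<alpha> + 1) (vec.span {a}) (vec.span {c}) (perp (vec.span {a}) \<inter> perp (vec.span {c})) l"
    (is "_ = ?g1 ** ?g2")
proof -
  have ca: "herm c a = 1" and ba: "herm b a = 0" and bc: "herm b c = 0"
    using cnj_herm[of a c] cnj_herm[of a b] cnj_herm[of c b] ac ab cb by simp_all
  define \<beta> where "\<beta> = herm b b"
  have \<beta>: "cnj \<beta> = \<beta>"
    by (simp add: \<beta>_def cnj_herm)
  note h = a c ac ab cb ca ba bc \<beta> \<beta>_def[symmetric]
  \<comment> \<open>The cross terms of \<open>c\<close> with \<open>- (\<beta> / 2) *s a\<close>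
    contribute \<open>- \<beta>\<close>, cancelling \<open>herm b b\<close>.\<close>
  have c'c': "herm c' c' = 0" and ac': "herm a c' = 1"
    by (simp_all add: c'_def h)
  define t where "t = 1 / (l - \<alpha>)"
  define f where "f = 1 - t"
  \<comment> \<open>As both parameters are real, the scalars on the two lines of each loop are
    reciprocal: \<open>f\<close> on \<open>a\<close> and \<open>1 / f\<close> on \<open>c'\<close>
    for \<open>?g1\<close>, then \<open>1 / f\<close> on \<open>a\<close> and \<open>f\<close> on
    \<open>c\<close> for \<open>?g2\<close>.\<close>
  have f: "(l - (of_real \<alpha> + 1)) / (l - \<alpha>) = f" "(l - \<alpha>) / (l - (of_real \<alpha> + 1)) = 1 / f"
    using l by (simp_all add: f_def t_def field_simps)
  have f0: "f \<noteq> 0"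
    using l by (simp add: f_def t_def field_simps)
  have "nil_loop \<alpha> (outer a b - outer b a) l *v x = (?g1 ** ?g2) *v x" for x
  proof -
    define A B C where "A = herm a x" and "B = herm b x" and "C = herm c x"
    have g1: "?g1 *v y = y + ((f - 1) * herm c' y) *s a + ((1 / f - 1) * herm a y) *s c'" for y
      by (simp only: simple_loop_span[OF a c'c' ac'] complex_cnj_add complex_cnj_complex_of_real complex_cnj_one f)
    have g2: "?g2 *v x = x + ((1 / f - 1) * C) *s a + ((f - 1) * A) *s c"
      by (simp only: simple_loop_span[OF a c ac] complex_cnj_add complex_cnj_complex_of_real complex_cnj_one f A_def C_def)
    have hc': "herm c' y = herm c y - herm b y - \<beta> / 2 * herm a y" for y
      by (simp add: c'_def h)
    have "(?g1 ** ?g2) *v x = ?g1 *v (?g2 *v x)"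
      by (simp add: matrix_vector_mul_assoc)
    \<comment> \<open>Pairing \<open>a\<close> with \<open>?g2 *v x\<close> gives
      \<open>f * A\<close>, so the terms in \<open>c\<close> and \<open>c'\<close> combine to
      \<open>(f - 1) * A\<close> times \<open>c - c'\<close>, a combination of \<open>a\<close> and
      \<open>b\<close>.\<close>
    also have "\<dots> = x + (t * B - t\<^sup>2 / 2 * \<beta> * A) *s a - (t * A) *s b"
      unfolding g1 g2 hc' using f0
      by (simp add: h A_def[symmetric] B_def[symmetric] C_def[symmetric] c'_def vec_eq_iff
          f_def divide_simps power2_eq_square) (simp add: algebra_simps)
    also have "\<dots> = nil_loop \<alpha> (outer a b - outer b a) l *v x"
      unfolding nil_loop_def t_def[symmetric]
      by (simp add: matrix_vector_mult_add_rdistrib mat_scale_mult_vec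
          matrix_vector_mul_assoc[symmetric] matrix_vector_mult_diff_rdistrib outer_mult_vec
          h A_def[symmetric] B_def[symmetric] vec_eq_iff algebra_simps)
    finally show ?thesis ..
  qed
  then show ?thesis by (simp add: matrix_eq)
qed

section \<open>Matrices of rank one\<close>

lemma rank_1_obtains_outer:
  fixes M :: "('p::finite, 'q::finite) cmat"
  assumes "rank M = 1"
  obtains a b where "M = outer a b" "a \<noteq> 0" "b \<noteq> 0"
proof -
  obtain B where B: "B \<subseteq> rows M" "rows M \<subseteq> vec.span B" "card B = vec.dim (rows M)"
    using vec.basis_exists[of "rows M"] by metis
  with assms obtain r where r: "B = {r}"
    by (auto simp: row_rank_def_gen card_1_singleton_iff)
  have "\<exists>k. row i M = k *s r" for i
    using B(2) r by (auto simp: vec.span_singleton rows_def)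
  then obtain d where d: "\<And>i. row i M = d i *s r"
    by metis
  define a :: "('p, 'q) cvec" where "a = (\<chi> i. d i)"
  \<comment> \<open>Sign and conjugation undo those in \<open>outer\<close>, so
    \<open>herm b\<close> is the plain pairing with the row \<open>r\<close>.\<close>
  define b :: "('p, 'q) cvec" where "b = (\<chi> j. herm_sign j * cnj (r $ j))"
  have "M $ i $ j = d i * r $ j" for i j
    using arg_cong[OF d[of i], of "\<lambda>v. v $ j"] by (simp add: row_def)
  then have M: "M = outer a b"
    by (simp add: vec_eq_iff outer_def a_def b_def)
  have "M \<noteq> 0"
  proof
    assume "M = 0"
    then have "rows M \<subseteq> {0}"
      by (auto simp: rows_def row_def vec_eq_iff)
    then have "vec.dim (rows M) = 0"
      by simp
    with assms show False by (simp add: row_rank_def_gen)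
  qed
  then have "a \<noteq> 0" "b \<noteq> 0"
    unfolding M by (auto simp: outer_def vec_eq_iff)
  with M that show ?thesis by blast
qed

section \<open>Orthogonal decomposition along \<open>V + sV\<close>\<close>

lemma mem_hyp_sum:
  assumes "vec.subspace V" "v \<in> V"
  shows "v \<in> hyp_sum V" "sgn_mat *v v \<in> hyp_sum V"
proof -
  have 0: "0 \<in> V"
    using assms(1) by (rule vec.subspace_0)
  show "v \<in> hyp_sum V"
    using set_plus_intro[OF assms(2) imageI[OF 0, of "(*v) sgn_mat"]] by (simp add: hyp_sum_def)
  show "sgn_mat *v v \<in> hyp_sum V"
    using set_plus_intro[OF 0 imageI[OF assms(2), of "(*v) sgn_mat"]] by (simp add: hyp_sum_def)
qed

text \<open>\<open>hyp_sum V\<close> is a complex subspace invariant under \<open>sgn_mat\<close>,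
  so its Euclidean complement is also orthogonal to it for the indefinite form.\<close>

lemma hyp_sum_perp_decomp:
  assumes V: "vec.subspace V"
  obtains y z where "y \<in> hyp_sum V" "z \<in> perp (hyp_sum V)" "x = y + z"
proof -
  let ?U = "hyp_sum V"
  have scale: "k *s w \<in> ?U" if w: "w \<in> ?U" for k w
  proof -
    obtain v1 v2 where v: "v1 \<in> V" "v2 \<in> V" "w = v1 + sgn_mat *v v2"
      using w by (auto simp: hyp_sum_def set_plus_def)
    then have "k *s w = k *s v1 + sgn_mat *v (k *s v2)"
      by (simp add: vec.scale_right_distrib vec.scale)
    moreover have "k *s v1 \<in> V" "k *s v2 \<in> V"
      using V v by (auto intro: vec.subspace_scale)
    ultimately show ?thesis
      unfolding hyp_sum_def by (metis image_eqI set_plus_intro)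
  qed
  have add: "w + w' \<in> ?U" if w: "w \<in> ?U" and w': "w' \<in> ?U" for w w'
  proof -
    obtain v1 v2 where v: "v1 \<in> V" "v2 \<in> V" "w = v1 + sgn_mat *v v2"
      using w by (auto simp: hyp_sum_def set_plus_def)
    obtain v1' v2' where v': "v1' \<in> V" "v2' \<in> V" "w' = v1' + sgn_mat *v v2'"
      using w' by (auto simp: hyp_sum_def set_plus_def)
    have "w + w' = (v1 + v1') + sgn_mat *v (v2 + v2')"
      using v v' by (simp add: matrix_vector_right_distrib)
    moreover have "v1 + v1' \<in> V" "v2 + v2' \<in> V"
      using V v v' by (auto intro: vec.subspace_add)
    ultimately show ?thesis
      unfolding hyp_sum_def by (metis image_eqI set_plus_intro)
  qed
  have sgn: "sgn_mat *v w \<in> ?U" if w: "w \<in> ?U" for w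
  proof -
    obtain v1 v2 where v: "v1 \<in> V" "v2 \<in> V" "w = v1 + sgn_mat *v v2"
      using w by (auto simp: hyp_sum_def set_plus_def)
    then have "sgn_mat *v w = v2 + sgn_mat *v v1"
      by (simp add: matrix_vector_right_distrib)
    with v show ?thesis
      unfolding hyp_sum_def by (metis image_eqI set_plus_intro)
  qed
  \<comment> \<open>The Euclidean decomposition is applied over the reals, hence the restriction of
    scalars.\<close>
  have "subspace ?U"
  proof (rule subspaceI)
    show "0 \<in> ?U"
      using mem_hyp_sum(1)[OF V vec.subspace_0[OF V]] .
    show "r *\<^sub>R w \<in> ?U" if "w \<in> ?U" for r w
    proof -
      have "r *\<^sub>R w = complex_of_real r *s w"
        by (simp add: vec_eq_iff) (simp add: scaleR_conv_of_real)
      then show ?thesis using scale[OF that] by simp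
    qed
  qed (fact add)
  then have span: "span ?U = ?U"
    by (simp only: span_eq_iff)
  obtain y z where y: "y \<in> ?U" and z: "\<And>w. w \<in> ?U \<Longrightarrow> orthogonal z w" and x: "x = y + z"
    using orthogonal_subspace_decomp_exists[of ?U x] by (metis span)
  \<comment> \<open>\<open>Re (herm w z)\<close> is a Euclidean inner product with \<open>s w \<in> U\<close>; replacing \<open>w\<close> by \<open>\<i> w\<close> handles the imaginary part.\<close>
  have re: "Re (herm w z) = 0" if "w \<in> ?U" for w
    using z[OF sgn[OF that]]
    by (metis inner_commute orthogonal_def sgn_mat_involution sgn_mat_isometry Re_herm_sgn_mat)
  have "herm w z = 0" if "w \<in> ?U" for w
    using re[OF that] re[OF scale[OF that, of \<i>]] by (simp add: complex_eq_iff)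
  then have "z \<in> perp ?U"
    by (simp add: perp_def)
  with y x that show ?thesis by blast
qed

theorem proposition5p6:
  fixes \<alpha> :: real
    and V :: "('p::finite, 'q::finite) cvec set"
    and M N :: "('p, 'q) cmat"
  assumes "0 < CARD('p)" and "CARD('p) < CARD('q)"
    and "maximal_isotropic V"
    and "ext_by_zero V M"
    and "rank M = 1"
    and "N = M - adj M"
    and "rank N = 2"
  shows "\<exists>gs :: (complex \<times> complex \<times> ('p, 'q) cvec set \<times> ('p, 'q) cvec set \<times> ('p, 'q) cvec set) list.
    (\<forall>(\<mu>, \<nu>, L, K, W) \<in> set gs.
       isotropic_line L \<and> isotropic_line K \<and> lines_nonorth L K \<and> W = perp L \<inter> perp K) \<and>
    (\<forall>l::complex.
       l \<noteq> of_real \<alpha> \<longrightarrow> (\<forall>(\<mu>, \<nu>, L, K, W) \<in> set gs. l \<noteq> \<nu> \<and> l \<noteq> cnj \<mu>) \<longrightarrow>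
       nil_loop (of_real \<alpha>) N l =
         foldr (\<lambda>(\<mu>, \<nu>, L, K, W) A. simple_loop \<mu> \<nu> L K W l ** A) gs (mat 1))"
proof -
  have V: "vec.subspace V" and iso: "\<And>v w. v \<in> V \<Longrightarrow> w \<in> V \<Longrightarrow> herm v w = 0"
    using assms(3) by (auto simp: maximal_isotropic_def isotropic_def)
  have M_perp: "M *v x \<in> V" if "x \<in> perp (hyp_sum V)" for x
    using assms(4) that by (simp add: ext_by_zero_def)
  have M_hyp: "M *v x = 0" if "x \<in> hyp_sum V" for x
    using assms(4) that by (simp add: ext_by_zero_def)
  obtain a b where M: "M = outer a b" and a0: "a \<noteq> 0" and b0: "b \<noteq> 0"
    using rank_1_obtains_outer[OF assms(5)] .
  have N: "N = outer a b - outer b a"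
    by (simp add: assms(6) M adj_outer)
  have herm_sgn: "herm v (sgn_mat *v v) \<noteq> 0" if "v \<noteq> 0" for v :: "('p, 'q) cvec"
    using that by (simp add: herm_sgn_mat_self)
  have b_hyp: "herm b x = 0" if "x \<in> hyp_sum V" for x
    using M_hyp[OF that] a0 by (simp add: M outer_mult_vec)
  have a_V: "a \<in> V"
  proof -
    \<comment> \<open>\<open>herm b\<close> is nonzero on \<open>sgn_mat *v b\<close> but kills its
      part in \<open>hyp_sum V\<close>; so \<open>M\<close> sends the part \<open>z\<close> to a
      nonzero multiple of \<open>a\<close>.\<close>
    obtain y z where yz: "y \<in> hyp_sum V" "z \<in> perp (hyp_sum V)" "sgn_mat *v b = y + z"
      using hyp_sum_perp_decomp[OF V] .
    then have "herm b z \<noteq> 0"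
      using herm_sgn[OF b0] b_hyp[OF yz(1)] by simp
    moreover have "herm b z *s a \<in> V"
      using M_perp[OF yz(2)] by (simp add: M outer_mult_vec)
    ultimately show ?thesis
      using vec.subspace_scale[OF V, of "herm b z *s a" "1 / herm b z"] by simp
  qed
  \<comment> \<open>The hyperbolic partner of \<open>a\<close>: isotropic because
    \<open>sgn_mat\<close> preserves the form, and orthogonal to \<open>b\<close> because it lies in
    \<open>hyp_sum V\<close>.\<close>
  define c where "c = (1 / herm a (sgn_mat *v a)) *s (sgn_mat *v a)"
  have aa: "herm a a = 0"
    using iso a_V by simp
  have ac: "herm a c = 1"
    using herm_sgn[OF a0] by (simp add: c_def)
  have cc: "herm c c = 0"
    by (simp add: c_def aa)
  have ba: "herm b a = 0" and bc: "herm b c = 0"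
    using b_hyp mem_hyp_sum[OF V a_V] by (simp_all add: c_def)
  have ab: "herm a b = 0" and cb: "herm c b = 0"
    using cnj_herm[of b a] cnj_herm[of b c] ba bc by simp_all
  define c' where "c' = c - b - (herm b b / 2) *s a"
  have "herm c a = 1"
    using cnj_herm[of a c] ac by simp
  then have c'c': "herm c' c' = 0" and ac': "herm a c' = 1"
    by (simp_all add: c'_def aa cc ac ab ba bc cb cnj_herm)
  have c0: "c \<noteq> 0" and c'0: "c' \<noteq> 0"
    using ac ac' by auto
  let ?W = "\<lambda>v. perp (vec.span {a}) \<inter> perp (vec.span {v})"
  let ?gs = "[(complex_of_real \<alpha> + 1, complex_of_real \<alpha>, vec.span {a}, vec.span {c'}, ?W c'),
    (complex_of_real \<alpha>, complex_of_real \<alpha> + 1, vec.span {a}, vec.span {c}, ?W c)]"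
  show ?thesis
  proof (rule exI[of _ ?gs], intro conjI allI impI)
    show "\<forall>(\<mu>, \<nu>, L, K, W) \<in> set ?gs.
       isotropic_line L \<and> isotropic_line K \<and> lines_nonorth L K \<and> W = perp L \<inter> perp K"
      using aa cc c'c' a0 c0 c'0 ac ac' by (simp add: isotropic_line_span lines_nonorth_span)
    fix l :: complex
    assume "l \<noteq> of_real \<alpha>" "\<forall>(\<mu>, \<nu>, L, K, W) \<in> set ?gs. l \<noteq> \<nu> \<and> l \<noteq> cnj \<mu>"
    \<comment> \<open>Both factors have their poles at \<open>\<alpha>\<close> and
      \<open>\<alpha> + 1\<close>.\<close>
    then have "l \<noteq> of_real \<alpha>" "l \<noteq> of_real \<alpha> + 1"
      by auto
    then show "nil_loop (of_real \<alpha>) N l =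
         foldr (\<lambda>(\<mu>, \<nu>, L, K, W) A. simple_loop \<mu> \<nu> L K W l ** A) ?gs (mat 1)"
      unfolding N using nil_loop_factorization[OF aa cc ac ab cb, of l \<alpha>, folded c'_def] by simp
  qed
qed

end
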